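(* For any integer $k \geq 2$, as formal power series in $q,r,t$, $$C_k(q,r,t) = \frac{\sum_{i \geq 0} \left( C_k(t)^{i+1} - q^{i+1} \right) r^i}{1-q+q^k t}.$$
   Context: For an integer $k\ge 2$ and integers $\alpha,\beta, n\ge 0$, a raised $k$-Dyck path of shape $(\alpha,\beta)$ with $n$ down steps is an integer lattice path from $(0,\alpha)$ to $(kn+\beta-\alpha,\beta)$ using steps $U=(1,1)$ and $D=(1,1-k)$ that stays weakly above the line $y=0$ (it has exactly $n$ steps $D$). Let $C^k_{n,(\alpha,\beta)}$ be the number of such paths (the empty path counts when $n=0$, $\alpha=\beta$). Define $C_k(q,r,t) = \sum_{\alpha,\beta,n \geq 0} C^k_{n,(\alpha,\beta)} q^\alpha r^\beta t^n$. Let $C_k(t)=\sum_{n\ge0} \frac{1}{kn+1}\binom{kn+1}{n} t^n$ be the generating function of the $k$-Catalan numbers; it satisfies $C_k(t)=1+tC_k(t)^k$. *)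

theory Defs
  imports
    "HOL-Computational_Algebra.Formal_Power_Series"
    "HOL-Library.Product_Plus"
begin

datatype step = U | D

fun step_vec :: "nat \<Rightarrow> step \<Rightarrow> int \<times> int" where
  "step_vec k U = (1, 1)"
| "step_vec k D = (1, 1 - int k)"

definition walk_end :: "nat \<Rightarrow> int \<times> int \<Rightarrow> step list \<Rightarrow> int \<times> int" where
  "walk_end k p s = p + sum_list (map (step_vec k) s)"

text \<open>A path with given starting point is represented by its list of steps; its lattice points are
  the end points of the prefixes. The end point lives in the integers, so that there is no path
  when \<open>k n + \<beta> - \<alpha> < 0\<close>.\<close>

definition raised_dyck_paths :: "nat \<Rightarrow> nat \<Rightarrow> nat \<Rightarrow> nat \<Rightarrow> step list set" where
  "raised_dyck_paths k \<alpha> \<beta> n =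
     {s. walk_end k (0, int \<alpha>) s = (int k * int n + int \<beta> - int \<alpha>, int \<beta>) \<and>
         (\<forall>j\<le>length s. 0 \<le> snd (walk_end k (0, int \<alpha>) (take j s)))}"

definition num_raised_dyck_paths :: "nat \<Rightarrow> nat \<Rightarrow> nat \<Rightarrow> nat \<Rightarrow> nat" where
  "num_raised_dyck_paths k \<alpha> \<beta> n = card (raised_dyck_paths k \<alpha> \<beta> n)"

lemma fst_walk_end: "fst (walk_end k p s) = fst p + int (length s)"
proof -
  have "fst (step_vec k x) = 1" for x by (cases x) auto
  then have "fst (sum_list (map (step_vec k) s)) = int (length s)"
    by (induction s) auto
  then show ?thesis by (simp add: walk_end_def)
qed

lemma snd_walk_end:
  "snd (walk_end k p s) = snd p + int (length s) - int k * int (count_list s D)"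
proof -
  have "snd (sum_list (map (step_vec k) s)) = int (length s) - int k * int (count_list s D)"
  proof (induction s)
    case (Cons x s)
    then show ?case by (cases x) (auto simp: algebra_simps)
  qed simp
  then show ?thesis by (simp add: walk_end_def)
qed

lemma raised_dyck_paths_count_D:
  assumes "k \<ge> 2" "s \<in> raised_dyck_paths k \<alpha> \<beta> n"
  shows "count_list s D = n"
  using assms fst_walk_end[of k "(0, int \<alpha>)" s] snd_walk_end[of k "(0, int \<alpha>)" s]
  by (auto simp: raised_dyck_paths_def)

lemma finite_raised_dyck_paths: "finite (raised_dyck_paths k \<alpha> \<beta> n)"
proof (rule finite_subset)
  have "finite (UNIV :: step set)"
    by (rule finite_subset[of _ "{U, D}"]) (auto intro: step.exhaust)
  then show "finite {s :: step list. set s \<subseteq> UNIV \<and> length s = nat (int k * int n + int \<beta> - int \<alpha>)}"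
    by (rule finite_lists_length_eq)
  show "raised_dyck_paths k \<alpha> \<beta> n \<subseteq>
      {s. set s \<subseteq> UNIV \<and> length s = nat (int k * int n + int \<beta> - int \<alpha>)}"
  proof
    fix s assume "s \<in> raised_dyck_paths k \<alpha> \<beta> n"
    with fst_walk_end[of k "(0, int \<alpha>)" s]
    have "int (length s) = int k * int n + int \<beta> - int \<alpha>"
      by (simp add: raised_dyck_paths_def)
    then show "s \<in> {s. set s \<subseteq> UNIV \<and> length s = nat (int k * int n + int \<beta> - int \<alpha>)}"
      by (metis (mono_tags, lifting) mem_Collect_eq nat_int subset_UNIV)
  qed
qed

text \<open>Power series in \<open>q, r, t\<close> over the rationals, as series in \<open>r\<close> whose coefficients are
  series in \<open>q\<close> whose coefficients are series in \<open>t\<close>.\<close>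

type_synonym fps_qrt = "rat fps fps fps"

definition fps_t_qrt :: "rat fps \<Rightarrow> fps_qrt" where
  "fps_t_qrt f = fps_const (fps_const f)"

definition var_q :: fps_qrt where "var_q = fps_const fps_X"
definition var_r :: fps_qrt where "var_r = fps_X"
definition var_t :: fps_qrt where "var_t = fps_t_qrt fps_X"

definition raised_dyck_gf :: "nat \<Rightarrow> fps_qrt" where
  "raised_dyck_gf k =
     Abs_fps (\<lambda>\<beta>. Abs_fps (\<lambda>\<alpha>. Abs_fps (\<lambda>n. of_nat (num_raised_dyck_paths k \<alpha> \<beta> n))))"

definition catalan_gf :: "nat \<Rightarrow> rat fps" where
  "catalan_gf k = Abs_fps (\<lambda>n. 1 / of_nat (k * n + 1) * of_nat ((k * n + 1) choose n))"

text \<open>Infinite sums of series in \<open>r\<close> are taken in the \<open>r\<close>-adic topology; the following lemma gives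
  convergence of \<open>\<Sum>\<^sub>i a\<^sub>i r\<^sup>i\<close> when each \<open>a\<^sub>i\<close> is free of \<open>r\<close>.\<close>

lemma sums_var_r: "(\<lambda>i. fps_const (a i) * var_r ^ i) sums Abs_fps a"
proof -
  have "(\<lambda>n. \<Sum>i<Suc n. fps_const (a i) * var_r ^ i) \<longlonglongrightarrow> Abs_fps a"
    using fps_notation[of "Abs_fps a"]
    by (simp add: var_r_def lessThan_Suc_atMost atMost_atLeast0 del: sum.lessThan_Suc)
  then show ?thesis
    unfolding sums_def by (rule LIMSEQ_imp_Suc)
qed

text \<open>Division on nested series is a total operation that is only well behaved for suitable
  divisors; the following lemma shows that the divisor of interest is inverted correctly.\<close>

lemma divide_kernel_eq_iff:
  assumes "k \<ge> 2"
  shows "f / (1 - var_q + var_q ^ k * var_t) = g \<longleftrightarrow> f = g * (1 - var_q + var_q ^ k * var_t)"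
proof -
  define d :: "rat fps fps" where "d = 1 - fps_X + fps_X ^ k * fps_const fps_X"
  have D: "1 - var_q + var_q ^ k * var_t = fps_const d"
    by (simp add: var_q_def var_t_def fps_t_qrt_def d_def flip: fps_const_1_eq_1)
  have d0: "fps_nth d 0 = 1" using assms by (simp add: d_def)
  have inv1: "inverse (1 :: rat fps) = 1" by (rule fps_inverse_one)
  have dinv: "d * inverse d = 1"
    unfolding fps_inverse_def[of d] by (rule fps_right_inverse) (simp only: d0 inv1 mult_1_right)
  have dnz: "d \<noteq> 0" using d0 by auto
  have inv: "fps_const d * inverse (fps_const d) = (1 :: fps_qrt)"
    unfolding fps_inverse_def[of "fps_const d"]
    by (rule fps_right_inverse) (simp only: fps_nth_fps_const dinv if_True simp_thms)
  have div: "f / fps_const d = f * inverse (fps_const d)" for f :: fps_qrt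
    using dnz by (simp add: fps_divide_def)
  have inv': "inverse (fps_const d) * fps_const d = (1 :: fps_qrt)"
    using inv by (simp only: mult.commute)
  show ?thesis unfolding D div
  proof
    assume "f * inverse (fps_const d) = g"
    then have "g * fps_const d = f * (inverse (fps_const d) * fps_const d)"
      by (simp only: mult.assoc flip: \<open>f * inverse (fps_const d) = g\<close>)
    then show "f = g * fps_const d" by (simp only: inv' mult_1_right)
  next
    assume "f = g * fps_const d"
    then have "f * inverse (fps_const d) = g * (fps_const d * inverse (fps_const d))"
      by (simp only: mult.assoc)
    then show "f * inverse (fps_const d) = g" by (simp only: inv mult_1_right)
  qed
qed

end

theory Submission
  imports Defs
begin

unbundle fps_syntax

text \<open>Removing the first step of a path gives a linear recurrence for the series
  \<open>G\<^sub>\<beta>(q,t)\<close> of paths ending at height \<open>\<beta>\<close>, namely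
  \<open>(1 - q + q\<^sup>k t) G\<^sub>\<beta>(q,t) = G\<^sub>\<beta>(0,t) - q\<^bsup>\<beta>+1\<^esup>\<close>. Each coefficient of \<open>t\<^sup>n\<close> in \<open>G\<^sub>\<beta>\<close> is a polynomial
  in \<open>q\<close>, so \<open>q = C\<^sub>k(t)\<close> may be substituted; this kills the kernel and leaves
  \<open>G\<^sub>\<beta>(0,t) = C\<^sub>k(t)\<^bsup>\<beta>+1\<^esup>\<close>. The equation \<open>C\<^sub>k = 1 + t C\<^sub>k\<^sup>k\<close> follows from Pascal's rule for the
  Raney numbers, which are the coefficients of the powers of \<open>C\<^sub>k\<close>.\<close>

section \<open>Raney numbers\<close>

text \<open>This is \<open>m / (m + k n) \<cdot> (m + k n choose n)\<close>, written so that \<open>m = n = 0\<close> needs no convention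
  for \<open>0 / 0\<close> and Pascal's rule applies directly.\<close>

fun raney :: "nat \<Rightarrow> nat \<Rightarrow> nat \<Rightarrow> rat" where
  "raney k m 0 = 1"
| "raney k m (Suc n) = of_nat ((m + k * Suc n) choose Suc n) -
     of_nat k * of_nat ((m + k * Suc n - 1) choose n)"

text \<open>By absorption the two terms defining \<open>raney\<close> cancel when m = 0.\<close>

lemma raney_0_Suc:
  assumes "k \<ge> 1"
  shows "raney k 0 (Suc n) = 0"
proof -
  have "Suc n * (k * Suc n choose Suc n) = Suc n * (k * ((k * Suc n - 1) choose n))"
    using binomial_absorption[of n "k * Suc n"] by (simp add: algebra_simps)
  then have "(k * Suc n choose Suc n) = k * ((k * Suc n - 1) choose n)"
    by (simp only: mult_cancel1) simp
  then show ?thesis by (simp del: mult_Suc_right)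
qed

text \<open>Pascal's rule splits each of the two binomials on the left, and the four pieces regroup
  into the right-hand side because all upper indices are \<open>N\<close>, \<open>Suc N\<close> or
  \<open>Suc (Suc N)\<close>.\<close>

lemma raney_Suc_Suc:
  assumes "k \<ge> 1"
  shows "raney k (Suc m) (Suc n) = raney k m (Suc n) + raney k (m + k) n"
proof -
  define N where "N = m + k * Suc n - 1"
  have N: "m + k * Suc n = Suc N" "Suc m + k * Suc n = Suc (Suc N)" "m + k + k * n = Suc N"
    using assms by (auto simp: N_def)
  show ?thesis
    by (cases n) (use N in \<open>simp_all add: algebra_simps\<close>)
qed

lemma raney_1: "raney k 1 n = 1 / of_nat (k * n + 1) * of_nat ((k * n + 1) choose n)"
proof (cases n)
  case (Suc j)
  define N where "N = k * n"
  have "n * (Suc N choose n) = Suc N * (N choose j)"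
    using binomial_absorption[of j "Suc N"] Suc by simp
  then have "(of_nat n :: rat) * of_nat (Suc N choose n) = of_nat (Suc N) * of_nat (N choose j)"
    by (metis of_nat_mult)
  \<comment> \<open>The factor k turns \<open>n\<close> into \<open>N = k * n\<close>, so that
    \<open>Suc N\<close> times the difference defining \<open>raney k 1 n\<close> collapses to one
    binomial.\<close>
  then have "of_nat k * (of_nat n * of_nat (Suc N choose n) :: rat)
      = of_nat k * (of_nat (Suc N) * of_nat (N choose j))"
    by simp
  then have *: "(of_nat N :: rat) * of_nat (Suc N choose n) = of_nat k * of_nat (N choose j) * of_nat (Suc N)"
    by (simp add: N_def algebra_simps)
  have "raney k 1 n = of_nat (Suc N choose n) - of_nat k * of_nat (N choose j)"
    using Suc by (simp add: N_def del: binomial_Suc_Suc)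
  moreover have "\<dots> * of_nat (Suc N) = of_nat (Suc N choose n)"
    using * by (simp add: algebra_simps del: binomial_Suc_Suc)
  ultimately have "raney k 1 n * of_nat (Suc N) = of_nat (Suc N choose n)"
    by simp
  then have "raney k 1 n = 1 / of_nat (Suc N) * of_nat (Suc N choose n)"
    by (simp add: eq_divide_eq del: binomial_Suc_Suc of_nat_Suc)
  then show ?thesis by (simp add: N_def)
qed simp

definition raney_gf :: "nat \<Rightarrow> nat \<Rightarrow> rat fps" where
  "raney_gf k m = Abs_fps (raney k m)"

lemma raney_gf_0: "k \<ge> 1 \<Longrightarrow> raney_gf k 0 = 1"
  by (rule fps_ext, rename_tac n, case_tac n) (auto simp: raney_gf_def raney_0_Suc simp del: raney.simps(2))

lemma raney_gf_Suc: "k \<ge> 1 \<Longrightarrow> raney_gf k (Suc m) = raney_gf k m + fps_X * raney_gf k (m + k)"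
  by (rule fps_ext, rename_tac n, case_tac n)
     (auto simp: raney_gf_def raney_Suc_Suc simp del: raney.simps(2))

text \<open>\<open>raney_gf_Suc\<close> lowers the index by one at the same coefficient, or raises
  it by k at the previous coefficient. Hence an outer induction over the coefficient, for all
  \<open>a\<close> at once, and an inner one over \<open>a\<close>.\<close>

lemma raney_gf_add:
  assumes "k \<ge> 1"
  shows "raney_gf k (a + b) = raney_gf k a * raney_gf k b"
proof (rule fps_ext)
  fix n
  show "raney_gf k (a + b) $ n = (raney_gf k a * raney_gf k b) $ n"
  proof (induction n arbitrary: a)
    case 0
    then show ?case by (simp add: raney_gf_def)
  next
    case (Suc n)
    note IH = Suc.IH
    show ?case
    proof (induction a)
      case 0
      then show ?case using assms by (simp add: raney_gf_0)
    next
      case (Suc a)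
      then show ?case
        using assms IH[of "a + k"]
        by (simp add: raney_gf_Suc distrib_right mult.assoc add.commute add.left_commute)
    qed
  qed
qed

lemma raney_gf_1: "raney_gf k 1 = catalan_gf k"
  unfolding raney_gf_def catalan_gf_def using raney_1 by presburger

lemma raney_gf_eq_power: "k \<ge> 1 \<Longrightarrow> raney_gf k m = catalan_gf k ^ m"
proof (induction m)
  case (Suc m)
  then show ?case using raney_gf_add[of k 1 m] by (simp add: raney_gf_1[simplified])
qed (simp add: raney_gf_0)

lemma catalan_gf_equation: "k \<ge> 1 \<Longrightarrow> catalan_gf k = 1 + fps_X * catalan_gf k ^ k"
  using raney_gf_Suc[of k 0] by (simp add: raney_gf_eq_power)

section \<open>First-step decomposition\<close>

lemma raised_dyck_paths_iff:
  "s \<in> raised_dyck_paths k \<alpha> \<beta> n \<longleftrightarrow>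
     int (length s) = int k * int n + int \<beta> - int \<alpha> \<and>
     int \<alpha> + int (length s) - int k * int (count_list s D) = int \<beta> \<and>
     (\<forall>j\<le>length s. 0 \<le> int \<alpha> + int j - int k * int (count_list (take j s) D))"
  by (auto simp: raised_dyck_paths_def prod_eq_iff fst_walk_end snd_walk_end)

lemma all_le_Suc_iff: "(\<forall>j\<le>Suc n. P j) \<longleftrightarrow> P 0 \<and> (\<forall>j\<le>n. P (Suc j))"
  by (metis Suc_le_mono not0_implies_Suc zero_le)

lemma Nil_in_raised_dyck_paths_iff:
  "k \<ge> 1 \<Longrightarrow> [] \<in> raised_dyck_paths k \<alpha> \<beta> n \<longleftrightarrow> \<alpha> = \<beta> \<and> n = 0"
  by (auto simp: raised_dyck_paths_iff)

lemma U_in_raised_dyck_paths_iff: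
  "U # s \<in> raised_dyck_paths k \<alpha> \<beta> n \<longleftrightarrow> s \<in> raised_dyck_paths k (Suc \<alpha>) \<beta> n"
  by (auto simp: raised_dyck_paths_iff all_le_Suc_iff algebra_simps)

lemma D_in_raised_dyck_paths_iff:
  assumes "k \<ge> 2"
  shows "D # s \<in> raised_dyck_paths k \<alpha> \<beta> n \<longleftrightarrow>
     k \<le> Suc \<alpha> \<and> n \<ge> 1 \<and> s \<in> raised_dyck_paths k (Suc \<alpha> - k) \<beta> (n - 1)"
proof (cases "k \<le> Suc \<alpha> \<and> n \<ge> 1")
  case True
  \<comment> \<open>This parametrization removes the truncated subtractions; both sides then state
    the same length and height conditions.\<close>
  then obtain a m where "Suc \<alpha> = a + k" "n = Suc m"
    by (metis One_nat_def Suc_le_D le_add_diff_inverse2)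
  moreover obtain k' where "k = Suc k'" using assms by (cases k) auto
  ultimately have "k = Suc k'" "\<alpha> = a + k'" "n = Suc m" by auto
  then show ?thesis
    by (simp add: raised_dyck_paths_iff all_le_Suc_iff algebra_simps)
next
  case False
  have "D # s \<notin> raised_dyck_paths k \<alpha> \<beta> n"
  proof
    assume D: "D # s \<in> raised_dyck_paths k \<alpha> \<beta> n"
    have "n \<ge> 1" using raised_dyck_paths_count_D[OF assms D] by simp
    moreover have "0 \<le> int \<alpha> + 1 - int k"
      \<comment> \<open>The prefix of length 1 already forces the bound.\<close>
      using D unfolding raised_dyck_paths_iff
      by (auto dest!: spec[of _ 1])
    ultimately show False using False by linarith
  qed
  then show ?thesis using False by blast
qed

lemma num_raised_dyck_paths_rec:
  assumes "k \<ge> 2"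
  shows "num_raised_dyck_paths k \<alpha> \<beta> n =
     (if \<alpha> = \<beta> \<and> n = 0 then 1 else 0) + num_raised_dyck_paths k (Suc \<alpha>) \<beta> n +
     (if k \<le> Suc \<alpha> \<and> n \<ge> 1 then num_raised_dyck_paths k (Suc \<alpha> - k) \<beta> (n - 1) else 0)"
proof -
  let ?R = "raised_dyck_paths k"
  let ?E = "if \<alpha> = \<beta> \<and> n = 0 then {[]} else {} :: step list set"
  let ?S = "if k \<le> Suc \<alpha> \<and> n \<ge> 1 then ?R (Suc \<alpha> - k) \<beta> (n - 1) else {}"
  have "?R \<alpha> \<beta> n = ?E \<union> (#) U ` ?R (Suc \<alpha>) \<beta> n \<union> (#) D ` ?S"
  proof (rule set_eqI)
    fix s
    show "s \<in> ?R \<alpha> \<beta> n \<longleftrightarrow> s \<in> ?E \<union> (#) U ` ?R (Suc \<alpha>) \<beta> n \<union> (#) D ` ?S"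
    proof (cases s)
      case Nil
      then show ?thesis using assms by (auto simp: Nil_in_raised_dyck_paths_iff)
    next
      case (Cons x xs)
      then show ?thesis using assms
        by (cases x) (auto simp: U_in_raised_dyck_paths_iff D_in_raised_dyck_paths_iff)
    qed
  qed
  moreover have "card (?E \<union> (#) U ` ?R (Suc \<alpha>) \<beta> n \<union> (#) D ` ?S)
      = card (?E \<union> (#) U ` ?R (Suc \<alpha>) \<beta> n) + card ((#) D ` ?S)"
    by (rule card_Un_disjoint) (auto simp: finite_raised_dyck_paths)
  moreover have "card (?E \<union> (#) U ` ?R (Suc \<alpha>) \<beta> n) = card ?E + card ((#) U ` ?R (Suc \<alpha>) \<beta> n)"
    by (rule card_Un_disjoint) (auto simp: finite_raised_dyck_paths)
  moreover have "card ((#) x ` A) = card A" for x and A :: "step list set"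
    by (simp add: card_image)
  moreover have "card ?E = (if \<alpha> = \<beta> \<and> n = 0 then 1 else 0)" by simp
  moreover have "card ?S = (if k \<le> Suc \<alpha> \<and> n \<ge> 1 then card (?R (Suc \<alpha> - k) \<beta> (n - 1)) else 0)"
    by simp
  ultimately show ?thesis
    unfolding num_raised_dyck_paths_def by presburger
qed

text \<open>Such a path would have negative length. This bound makes each coefficient of
  \<open>t ^ n\<close> a polynomial in q.\<close>

lemma num_raised_dyck_paths_eq_0:
  "k * n + \<beta> < \<alpha> \<Longrightarrow> num_raised_dyck_paths k \<alpha> \<beta> n = 0"
proof -
  assume "k * n + \<beta> < \<alpha>"
  then have "int k * int n + int \<beta> - int \<alpha> < 0"
    by (metis diff_less_0_iff_less of_nat_add of_nat_less_iff of_nat_mult)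
  then have "raised_dyck_paths k \<alpha> \<beta> n = {}"
    by (auto simp: raised_dyck_paths_iff)
  then show ?thesis by (simp add: num_raised_dyck_paths_def)
qed

section \<open>The kernel method\<close>

text \<open>The finite sums stand in for the substitution \<open>q = c\<close> in \<open>\<Sum>\<alpha>. a \<alpha> * q ^ \<alpha>\<close>: they differ by
  terms that do not contribute to a given coefficient once \<open>M\<close> is large.\<close>

lemma kernel_telescope:
  fixes a :: "nat \<Rightarrow> 'a::comm_ring_1" and c t :: 'a
  assumes c: "c = 1 + t * c ^ k" and k: "k \<ge> 1"
    and rec: "\<And>\<alpha>. a \<alpha> = (if \<alpha> = \<beta> then 1 else 0) + a (Suc \<alpha>) +
                (if k \<le> Suc \<alpha> then t * a (Suc \<alpha> - k) else 0)"
  defines "b \<equiv> \<lambda>\<alpha>. t * c ^ (\<alpha> + k) * a \<alpha>"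
  shows "a 0 + (\<Sum>\<alpha><M. b \<alpha>) =
           (if \<beta> < M then c ^ Suc \<beta> else 0) + c ^ M * a M + (\<Sum>\<alpha><Suc M - k. b \<alpha>)"
proof (induction M)
  case 0
  then show ?case using k by simp
next
  case (Suc M)
  \<comment> \<open>Replacing one factor \<open>c\<close> by \<open>1 + t * c ^ k\<close> expresses
    that the kernel \<open>1 - q + q ^ k * t\<close> vanishes at \<open>q = c\<close>.\<close>
  have kernel: "c ^ Suc M * a M = c ^ M * a M + b M"
    by (subst power_Suc, subst (1) c) (simp add: b_def algebra_simps power_add)
  \<comment> \<open>This is the recurrence at \<open>M\<close> times \<open>c ^ Suc M\<close>; in
    the last term the exponent is \<open>(Suc M - k) + k\<close>, as \<open>b (Suc M - k)\<close>
    requires.\<close>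
  have step: "c ^ Suc M * a M = (if M = \<beta> then c ^ Suc M else 0) + c ^ Suc M * a (Suc M) +
      (if k \<le> Suc M then b (Suc M - k) else 0)"
    by (subst rec) (auto simp: b_def distrib_left ac_simps)
  have "a 0 + (\<Sum>\<alpha><Suc M. b \<alpha>) = (a 0 + (\<Sum>\<alpha><M. b \<alpha>)) + b M"
    by (simp add: add.assoc)
  also have "\<dots> = (if \<beta> < M then c ^ Suc \<beta> else 0) + (c ^ M * a M + b M) + (\<Sum>\<alpha><Suc M - k. b \<alpha>)"
    unfolding Suc.IH by (simp only: ac_simps)
  also have "\<dots> = ((if \<beta> < M then c ^ Suc \<beta> else 0) + (if M = \<beta> then c ^ Suc M else 0)) +
      c ^ Suc M * a (Suc M) + ((\<Sum>\<alpha><Suc M - k. b \<alpha>) + (if k \<le> Suc M then b (Suc M - k) else 0))"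
    unfolding kernel[symmetric] step by (simp only: ac_simps)
  also have "(\<Sum>\<alpha><Suc M - k. b \<alpha>) + (if k \<le> Suc M then b (Suc M - k) else 0)
      = (\<Sum>\<alpha><Suc (Suc M) - k. b \<alpha>)"
    by (auto simp: Suc_diff_le)
  also have "(if \<beta> < M then c ^ Suc \<beta> else 0) + (if M = \<beta> then c ^ Suc M else 0)
      = (if \<beta> < Suc M then c ^ Suc \<beta> else 0)"
    by auto
  finally show ?case .
qed

lemma fps_mult_nth_eq_0:
  fixes f g :: "'a::semiring_0 fps"
  assumes "\<And>i. i \<le> n \<Longrightarrow> g $ i = 0"
  shows "(f * g) $ n = 0"
  using assms by (simp add: fps_mult_nth)

lemma kernel_method:
  fixes a :: "nat \<Rightarrow> 'a::comm_ring_1 fps"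
  assumes c: "c = 1 + fps_X * c ^ k" and k: "k \<ge> 1"
    and rec: "\<And>\<alpha>. a \<alpha> = (if \<alpha> = \<beta> then 1 else 0) + a (Suc \<alpha>) +
                (if k \<le> Suc \<alpha> then fps_X * a (Suc \<alpha> - k) else 0)"
    and vanish: "\<And>\<alpha> n. k * n + \<beta> < \<alpha> \<Longrightarrow> a \<alpha> $ n = 0"
  shows "a 0 = c ^ Suc \<beta>"
proof (rule fps_ext)
  fix n
  \<comment> \<open>With this choice \<open>\<beta> < M\<close>, and both \<open>M\<close> and
    \<open>Suc M - k\<close> exceed \<open>k * n + \<beta>\<close>. So \<open>a M\<close> and all
    summands in which the two sums differ contribute nothing to coefficient n.\<close>
  define M where "M = k * n + \<beta> + k"
  define b where "b = (\<lambda>\<alpha>. fps_X * c ^ (\<alpha> + k) * a \<alpha>)"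
  have zero: "(f * a \<alpha>) $ n = 0" if "k * n + \<beta> < \<alpha>" for f \<alpha>
  proof (rule fps_mult_nth_eq_0, rule vanish)
    fix i assume "i \<le> n"
    then have "k * i \<le> k * n" by simp
    then show "k * i + \<beta> < \<alpha>" using that by linarith
  qed
  have "(\<Sum>\<alpha><M. b \<alpha> $ n) = (\<Sum>\<alpha><Suc M - k. b \<alpha> $ n)"
    by (rule sum.mono_neutral_right) (use k in \<open>auto simp: b_def M_def intro: zero\<close>)
  moreover have "a 0 + (\<Sum>\<alpha><M. b \<alpha>) = c ^ Suc \<beta> + c ^ M * a M + (\<Sum>\<alpha><Suc M - k. b \<alpha>)"
    using kernel_telescope[OF c k rec, of M] k by (simp add: b_def M_def)
  then have "(a 0 + (\<Sum>\<alpha><M. b \<alpha>)) $ n = (c ^ Suc \<beta> + c ^ M * a M + (\<Sum>\<alpha><Suc M - k. b \<alpha>)) $ n"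
    by (rule arg_cong)
  moreover have "(c ^ M * a M) $ n = 0" using k by (intro zero) (simp add: M_def)
  ultimately show "a 0 $ n = c ^ Suc \<beta> $ n"
    by (simp only: fps_add_nth fps_sum_nth) simp
qed

theorem theorem2p2:
  fixes k :: nat
  assumes "k \<ge> 2"
  shows "raised_dyck_gf k =
    (\<Sum>i. (fps_t_qrt (catalan_gf k) ^ (i + 1) - var_q ^ (i + 1)) * var_r ^ i) /
    (1 - var_q + var_q ^ k * var_t)"
proof -
  define c where "c = catalan_gf k"
  define a :: "nat \<Rightarrow> nat \<Rightarrow> rat fps"
    where "a \<beta> \<alpha> = Abs_fps (\<lambda>n. of_nat (num_raised_dyck_paths k \<alpha> \<beta> n))" for \<beta> \<alpha>
  define d :: "rat fps fps" where "d = 1 - fps_X + fps_X ^ k * fps_const fps_X"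
  have rec: "a \<beta> \<alpha> = (if \<alpha> = \<beta> then 1 else 0) + a \<beta> (Suc \<alpha>) +
                (if k \<le> Suc \<alpha> then fps_X * a \<beta> (Suc \<alpha> - k) else 0)" for \<beta> \<alpha>
  proof (rule fps_ext)
    fix n
    have "a \<beta> \<alpha> $ n = of_nat ((if \<alpha> = \<beta> \<and> n = 0 then 1 else 0) +
        num_raised_dyck_paths k (Suc \<alpha>) \<beta> n +
        (if k \<le> Suc \<alpha> \<and> n \<ge> 1 then num_raised_dyck_paths k (Suc \<alpha> - k) \<beta> (n - 1) else 0))"
      unfolding a_def fps_nth_Abs_fps by (subst num_raised_dyck_paths_rec[OF assms]) simp
    then show "a \<beta> \<alpha> $ n = ((if \<alpha> = \<beta> then 1 else 0) + a \<beta> (Suc \<alpha>) +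
                (if k \<le> Suc \<alpha> then fps_X * a \<beta> (Suc \<alpha> - k) else 0)) $ n"
      by (auto simp: a_def)
  qed
  have a0: "a \<beta> 0 = c ^ Suc \<beta>" for \<beta>
    using assms
    by (intro kernel_method[of c k "a \<beta>" \<beta>] rec)
       (auto simp: c_def a_def num_raised_dyck_paths_eq_0 intro: catalan_gf_equation)
  have gf: "raised_dyck_gf k = Abs_fps (\<lambda>\<beta>. Abs_fps (a \<beta>))"
    by (intro fps_ext) (simp add: raised_dyck_gf_def a_def)
  \<comment> \<open>Here the outer \<open>fps_X\<close> is q and the inner one is t. The constant
    coefficient is \<open>a0\<close>; the coefficient at \<open>Suc \<alpha>'\<close> is the
    recurrence at \<open>\<alpha>'\<close>, and this shift yields the exponent
    \<open>Suc \<beta>\<close>.\<close>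
  have kernel_eq: "Abs_fps (a \<beta>) * d = fps_const (c ^ Suc \<beta>) - fps_X ^ Suc \<beta>" for \<beta>
  proof (rule fps_ext)
    fix \<alpha>
    have "Abs_fps (a \<beta>) * d =
        Abs_fps (a \<beta>) - fps_X * Abs_fps (a \<beta>) + fps_X ^ k * (fps_const fps_X * Abs_fps (a \<beta>))"
      by (simp add: d_def algebra_simps)
    then have "(Abs_fps (a \<beta>) * d) $ \<alpha> =
        a \<beta> \<alpha> - (if \<alpha> = 0 then 0 else a \<beta> (\<alpha> - 1)) + (if \<alpha> < k then 0 else fps_X * a \<beta> (\<alpha> - k))"
      by (simp add: fps_X_power_mult_nth)
    also have "\<dots> = (fps_const (c ^ Suc \<beta>) - fps_X ^ Suc \<beta>) $ \<alpha>"
    proof (cases \<alpha>)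
      case 0
      then show ?thesis using assms by (simp add: a0)
    next
      case (Suc \<alpha>')
      then show ?thesis using rec[of \<beta> \<alpha>'] by (auto simp: fps_X_power_nth)
    qed
    finally show "(Abs_fps (a \<beta>) * d) $ \<alpha> = (fps_const (c ^ Suc \<beta>) - fps_X ^ Suc \<beta>) $ \<alpha>" .
  qed
  have "raised_dyck_gf k * fps_const d = Abs_fps (\<lambda>\<beta>. fps_const (c ^ Suc \<beta>) - fps_X ^ Suc \<beta>)"
    by (rule fps_ext) (simp only: gf kernel_eq fps_mult_right_const_nth fps_nth_Abs_fps)
  moreover have "1 - var_q + var_q ^ k * var_t = fps_const d"
    by (simp add: var_q_def var_t_def fps_t_qrt_def d_def flip: fps_const_1_eq_1)
  moreover have "(fps_t_qrt (catalan_gf k) ^ (i + 1) - var_q ^ (i + 1)) =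
      fps_const (fps_const (c ^ Suc i) - fps_X ^ Suc i)" for i
    by (simp add: fps_t_qrt_def var_q_def c_def fps_const_power del: power_Suc)
  then have "(\<Sum>i. (fps_t_qrt (catalan_gf k) ^ (i + 1) - var_q ^ (i + 1)) * var_r ^ i) =
      Abs_fps (\<lambda>\<beta>. fps_const (c ^ Suc \<beta>) - fps_X ^ Suc \<beta>)"
    using sums_unique[OF sums_var_r] by simp
  ultimately show ?thesis
    using divide_kernel_eq_iff[OF assms] by metis
qed

end
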